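(* Suppose $(\mathsf P,\mathsf{Opens})$ is a semitopology and $p\in\mathsf P$. Then: \begin{enumerate} \item If $p$ is weakly regular then $\overline{K(p)}=p_{\between}$. In symbols: $ p\in K(p) $ implies $\overline{K(p)}=p_{\between}. $ \item As an immediate corollary, if $p$ is regular then $\overline{K(p)}=p_{\between}$. \end{enumerate}
   Context: A semitopology is a pair $(\mathsf P,\mathsf{Opens})$ with $\mathsf{Opens}\subseteq\mathcal P(\mathsf P)$ containing $\varnothing$ and $\mathsf P$ and closed under arbitrary unions. Points $p,p'$ are intertwined when every open neighbourhood of $p$ intersects every open neighbourhood of $p'$; $p_{\between}$ denotes the set of points intertwined with $p$. $\mathrm{interior}(X)$ is the union of open sets contained in $X$, and $\overline X$ is the closure of $X$ (points every open neighbourhood of which intersects $X$). A set $T$ is topen when it is nonempty, open and transitive (for all open $O,O'$, if $O\cap T\neq\varnothing$ and $T\cap O'\neq\varnothing$ then $O\cap O'\neq\varnothing$). The community of $p$ is $K(p)=\mathrm{interior}(p_{\between})$; $p$ is weakly regular when $p\in K(p)$, and regular when $p\in K(p)$ and $K(p)$ is topen. *)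

theory Defs
  imports Main
begin

definition semitopology :: "'a set \<Rightarrow> 'a set set \<Rightarrow> bool" where
  "semitopology P Opens \<longleftrightarrow>
     Opens \<subseteq> Pow P \<and> {} \<in> Opens \<and> P \<in> Opens \<and>
     (\<forall>\<O>. \<O> \<subseteq> Opens \<longrightarrow> \<Union>\<O> \<in> Opens)"

definition intertwined :: "'a set set \<Rightarrow> 'a \<Rightarrow> 'a \<Rightarrow> bool" where
  "intertwined Opens p p' \<longleftrightarrow>
     (\<forall>U\<in>Opens. \<forall>V\<in>Opens. p \<in> U \<and> p' \<in> V \<longrightarrow> U \<inter> V \<noteq> {})"

definition intertwined_set :: "'a set \<Rightarrow> 'a set set \<Rightarrow> 'a \<Rightarrow> 'a set" where
  "intertwined_set P Opens p = {p' \<in> P. intertwined Opens p p'}"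

definition semi_interior :: "'a set set \<Rightarrow> 'a set \<Rightarrow> 'a set" where
  "semi_interior Opens X = \<Union>{U \<in> Opens. U \<subseteq> X}"

definition semi_closure :: "'a set \<Rightarrow> 'a set set \<Rightarrow> 'a set \<Rightarrow> 'a set" where
  "semi_closure P Opens X = {p \<in> P. \<forall>U\<in>Opens. p \<in> U \<longrightarrow> U \<inter> X \<noteq> {}}"

definition transitive_set :: "'a set set \<Rightarrow> 'a set \<Rightarrow> bool" where
  "transitive_set Opens T \<longleftrightarrow>
     (\<forall>U\<in>Opens. \<forall>V\<in>Opens. U \<inter> T \<noteq> {} \<and> T \<inter> V \<noteq> {} \<longrightarrow> U \<inter> V \<noteq> {})"

definition topen :: "'a set set \<Rightarrow> 'a set \<Rightarrow> bool" where
  "topen Opens T \<longleftrightarrow> T \<noteq> {} \<and> T \<in> Opens \<and> transitive_set Opens T"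

definition community :: "'a set \<Rightarrow> 'a set set \<Rightarrow> 'a \<Rightarrow> 'a set" where
  "community P Opens p = semi_interior Opens (intertwined_set P Opens p)"

definition weakly_regular :: "'a set \<Rightarrow> 'a set set \<Rightarrow> 'a \<Rightarrow> bool" where
  "weakly_regular P Opens p \<longleftrightarrow> p \<in> community P Opens p"

definition regular :: "'a set \<Rightarrow> 'a set set \<Rightarrow> 'a \<Rightarrow> bool" where
  "regular P Opens p \<longleftrightarrow> p \<in> community P Opens p \<and> topen Opens (community P Opens p)"

end

theory Submission
  imports Defs
begin

text \<open>The set of points intertwined with \<open>p\<close> is closed
  (\<open>semi_closure_intertwined_set_subset\<close>), so it contains the closure of its interior
  K(p). Conversely, a point intertwined with \<open>p\<close> lies in the closure of every open
  neighbourhood of \<open>p\<close> (\<open>intertwined_set_subset_semi_closure\<close>), and weak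
  regularity says exactly that K(p) is such a neighbourhood. Regularity includes weak regularity,
  which gives the corollary.\<close>

lemma semi_interior_subset: "semi_interior Opens X \<subseteq> X"
  unfolding semi_interior_def by blast

lemma semi_interior_open:
  assumes "semitopology P Opens"
  shows "semi_interior Opens X \<in> Opens"
proof -
  have "{U \<in> Opens. U \<subseteq> X} \<subseteq> Opens"
    by blast
  with assms show ?thesis
    unfolding semitopology_def semi_interior_def by blast
qed

lemma semi_closure_mono:
  assumes "X \<subseteq> Y"
  shows "semi_closure P Opens X \<subseteq> semi_closure P Opens Y"
  using assms unfolding semi_closure_def by blast

text \<open>An open neighbourhood \<open>V\<close> of a closure point \<open>x\<close> contains some
  \<open>y\<close> intertwined with \<open>p\<close>. Then \<open>V\<close> is also a neighbourhood
  of \<open>y\<close>, so it meets every open neighbourhood of \<open>p\<close>.\<close>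

lemma semi_closure_intertwined_set_subset:
  "semi_closure P Opens (intertwined_set P Opens p) \<subseteq> intertwined_set P Opens p"
proof
  fix x
  assume x: "x \<in> semi_closure P Opens (intertwined_set P Opens p)"
  have "U \<inter> V \<noteq> {}" if "U \<in> Opens" "V \<in> Opens" "p \<in> U" "x \<in> V" for U V
  proof -
    from x that obtain y where "y \<in> V" "intertwined Opens p y"
      unfolding semi_closure_def intertwined_set_def by blast
    with that show ?thesis
      unfolding intertwined_def by blast
  qed
  with x show "x \<in> intertwined_set P Opens p"
    unfolding semi_closure_def intertwined_set_def intertwined_def by blast
qed

text \<open>Fixing the neighbourhood \<open>U\<close> of \<open>p\<close> in the definition of
  \<open>intertwined\<close> leaves the condition for lying in the closure of
  \<open>U\<close>.\<close>

lemma intertwined_set_subset_semi_closure: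
  assumes "U \<in> Opens" and "p \<in> U"
  shows "intertwined_set P Opens p \<subseteq> semi_closure P Opens U"
  using assms unfolding intertwined_set_def intertwined_def semi_closure_def by blast

lemma semi_closure_community:
  assumes "semitopology P Opens" and "weakly_regular P Opens p"
  shows "semi_closure P Opens (community P Opens p) = intertwined_set P Opens p"
proof
  show "semi_closure P Opens (community P Opens p) \<subseteq> intertwined_set P Opens p"
    unfolding community_def
    using semi_closure_mono[OF semi_interior_subset] semi_closure_intertwined_set_subset
    by (rule subset_trans)
  \<comment> \<open>K(p) will serve as the neighbourhood \<open>U\<close> of \<open>p\<close>; it is
    open as a union of open sets.\<close>
  have "community P Opens p \<in> Opens"
    unfolding community_def using assms(1) by (rule semi_interior_open)
  moreover have "p \<in> community P Opens p"
    using assms(2) unfolding weakly_regular_def .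
  ultimately show "intertwined_set P Opens p \<subseteq> semi_closure P Opens (community P Opens p)"
    by (rule intertwined_set_subset_semi_closure)
qed

theorem theorem5p30:
  fixes P :: "'a set" and Opens :: "'a set set" and p :: 'a
  assumes "semitopology P Opens" and "p \<in> P"
  shows "(weakly_regular P Opens p \<longrightarrow>
            semi_closure P Opens (community P Opens p) = intertwined_set P Opens p) \<and>
         (regular P Opens p \<longrightarrow>
            semi_closure P Opens (community P Opens p) = intertwined_set P Opens p)"
proof -
  have "weakly_regular P Opens p" if "regular P Opens p"
    using that unfolding regular_def weakly_regular_def by blast
  with semi_closure_community[OF assms(1)] show ?thesis
    by blast
qed

end
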